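(* Let $X$ be a real Banach space and let $M \subseteq X$ be an $M$-ideal. If $M^*$ has the $w^*$-ball dentable property, then $X^*$ has the $w^*$-ball dentable property.
   Context: $B_X$ denotes the closed unit ball of a Banach space $X$, and $X^*$ its dual. For a bounded set $C \subseteq X^*$, $x \in X$ with $\|x\| = 1$ and $\alpha > 0$, the set $\{x^* \in C : x^*(x) > \sup_{c^* \in C} c^*(x) - \alpha\}$ is called a (open) $w^*$-slice of $C$. The dual space $X^*$ is said to have the $w^*$-ball dentable property ($w^*$-BDP) if $B_{X^*}$ has $w^*$-slices (determined by elements of $X$) of arbitrarily small diameter, i.e. for every $\varepsilon > 0$ there is a $w^*$-slice $S$ of $B_{X^*}$ with $\operatorname{diam}(S) < \varepsilon$. For $M^*$ the $w^*$-slices are determined by elements of $M$. A linear projection $P$ on a Banach space $Z$ is an $L$-projection if $\|z\| = \|Pz\| + \|z - Pz\|$ for all $z \in Z$. A closed subspace $M \subseteq X$ is an $M$-ideal if $M^\perp = \{x^* \in X^* : x^*|_M = 0\}$ is the kernel of an $L$-projection on $X^*$. *)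

theory Defs
  imports "HOL-Analysis.Analysis"
begin

text \<open>The dual of the whole space is the type of bounded linear functionals, with its operator
  norm and metric.\<close>

definition wstar_slice ::
    "('a::real_normed_vector \<Rightarrow>\<^sub>L real) set \<Rightarrow> 'a \<Rightarrow> real \<Rightarrow> ('a \<Rightarrow>\<^sub>L real) set" where
  "wstar_slice C x \<alpha> = {f \<in> C. blinfun_apply f x > (SUP g\<in>C. blinfun_apply g x) - \<alpha>}"

definition wstar_BDP :: "'a::real_normed_vector itself \<Rightarrow> bool" where
  "wstar_BDP (_ :: 'a itself) \<longleftrightarrow>
     (\<forall>\<epsilon>>0. \<exists>(x::'a) \<alpha>. norm x = 1 \<and> \<alpha> > 0 \<and> diameter (wstar_slice (cball 0 1) x \<alpha>) < \<epsilon>)"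

text \<open>A subspace is a set, not a type, so its dual is given by explicit carriers: the functionals
  are defined on the subspace only, i.e. they are \<^const>\<open>undefined\<close> outside of it. Neither
  \<^term>\<open>dual_norm_on M f\<close> nor \<^term>\<open>dual_dist_on M f g\<close> looks at values outside \<^term>\<open>M\<close>. The
  lemma \<open>wstar_BDP_on_UNIV\<close> below shows that both versions agree on the whole space.\<close>

definition dual_on :: "'a::real_normed_vector set \<Rightarrow> ('a \<Rightarrow> real) set" where
  "dual_on M = {f \<in> extensional M.
     (\<forall>x\<in>M. \<forall>y\<in>M. f (x + y) = f x + f y) \<and>
     (\<forall>c. \<forall>x\<in>M. f (c *\<^sub>R x) = c * f x) \<and>
     (\<exists>K. \<forall>x\<in>M. \<bar>f x\<bar> \<le> K * norm x)}"

definition dual_norm_on :: "'a::real_normed_vector set \<Rightarrow> ('a \<Rightarrow> real) \<Rightarrow> real" where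
  "dual_norm_on M f = (SUP x\<in>{x\<in>M. norm x \<le> 1}. \<bar>f x\<bar>)"

definition dual_dist_on ::
    "'a::real_normed_vector set \<Rightarrow> ('a \<Rightarrow> real) \<Rightarrow> ('a \<Rightarrow> real) \<Rightarrow> real" where
  "dual_dist_on M f g = dual_norm_on M (\<lambda>x. f x - g x)"

definition dual_diameter_on :: "'a::real_normed_vector set \<Rightarrow> ('a \<Rightarrow> real) set \<Rightarrow> real" where
  "dual_diameter_on M S = (if S = {} then 0 else SUP (f, g)\<in>S \<times> S. dual_dist_on M f g)"

definition dual_ball_on :: "'a::real_normed_vector set \<Rightarrow> ('a \<Rightarrow> real) set" where
  "dual_ball_on M = {f \<in> dual_on M. dual_norm_on M f \<le> 1}"

definition wstar_slice_on :: "('a \<Rightarrow> real) set \<Rightarrow> 'a \<Rightarrow> real \<Rightarrow> ('a \<Rightarrow> real) set" where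
  "wstar_slice_on C x \<alpha> = {f \<in> C. f x > (SUP g\<in>C. g x) - \<alpha>}"

definition wstar_BDP_on :: "'a::real_normed_vector set \<Rightarrow> bool" where
  "wstar_BDP_on M \<longleftrightarrow>
     (\<forall>\<epsilon>>0. \<exists>x\<in>M. \<exists>\<alpha>. norm x = 1 \<and> \<alpha> > 0 \<and>
        dual_diameter_on M (wstar_slice_on (dual_ball_on M) x \<alpha>) < \<epsilon>)"

definition annihilator :: "'a::real_normed_vector set \<Rightarrow> ('a \<Rightarrow>\<^sub>L real) set" where
  "annihilator M = {f. \<forall>x\<in>M. blinfun_apply f x = 0}"

definition L_projection :: "('z::real_normed_vector \<Rightarrow> 'z) \<Rightarrow> bool" where
  "L_projection P \<longleftrightarrow> linear P \<and> P \<circ> P = P \<and> (\<forall>z. norm z = norm (P z) + norm (z - P z))"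

definition M_ideal :: "'a::real_normed_vector set \<Rightarrow> bool" where
  "M_ideal M \<longleftrightarrow> subspace M \<and> closed M \<and>
     (\<exists>P :: ('a \<Rightarrow>\<^sub>L real) \<Rightarrow> ('a \<Rightarrow>\<^sub>L real). L_projection P \<and> {f. P f = 0} = annihilator M)"

lemma dual_on_UNIV: "dual_on (UNIV :: 'a::real_normed_vector set) = range blinfun_apply"
proof (intro equalityI subsetI)
  fix f :: "'a \<Rightarrow> real"
  assume "f \<in> dual_on UNIV"
  then have add: "\<And>x y. f (x + y) = f x + f y" and scale: "\<And>c x. f (c *\<^sub>R x) = c * f x"
    and "\<exists>K. \<forall>x. \<bar>f x\<bar> \<le> K * norm x"
    by (simp_all add: dual_on_def)
  then obtain K where "\<And>x. norm (f x) \<le> norm x * K"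
    by (auto simp: mult.commute)
  then have "bounded_linear f"
    by (intro bounded_linear_intro) (simp_all add: add scale)
  then show "f \<in> range blinfun_apply"
    by (metis bounded_linear_Blinfun_apply rangeI)
next
  fix f :: "'a \<Rightarrow> real"
  assume "f \<in> range blinfun_apply"
  then obtain g where f: "f = blinfun_apply g" by blast
  have "\<forall>x. \<bar>f x\<bar> \<le> norm g * norm x"
    using norm_blinfun[of g] by (simp add: f)
  then show "f \<in> dual_on UNIV"
    by (auto simp: dual_on_def f blinfun.add_right blinfun.scaleR_right)
qed

lemma dual_norm_on_UNIV:
  "dual_norm_on UNIV (blinfun_apply (f :: 'a::real_normed_vector \<Rightarrow>\<^sub>L real)) = norm f"
proof (rule antisym)
  let ?B = "{x\<in>UNIV. norm (x::'a) \<le> 1}"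
  have le: "\<bar>blinfun_apply f x\<bar> \<le> norm f" if "x \<in> ?B" for x
    using norm_blinfun[of f x] that mult_left_le[of "norm x" "norm f"] by simp
  show "dual_norm_on UNIV (blinfun_apply f) \<le> norm f"
    unfolding dual_norm_on_def by (rule cSUP_least) (use le in \<open>auto intro: exI[of _ 0]\<close>)
  have bdd: "bdd_above ((\<lambda>x. \<bar>blinfun_apply f x\<bar>) ` ?B)"
    using le by (rule bdd_aboveI2)
  have upper: "\<bar>blinfun_apply f x\<bar> \<le> dual_norm_on UNIV (blinfun_apply f)" if "norm x \<le> 1" for x
    unfolding dual_norm_on_def using that by (intro cSUP_upper bdd) simp
  show "norm f \<le> dual_norm_on UNIV (blinfun_apply f)"
  proof (rule norm_blinfun_bound)
    show "0 \<le> dual_norm_on UNIV (blinfun_apply f)"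
      using upper[of 0] by simp
    fix x
    show "norm (blinfun_apply f x) \<le> dual_norm_on UNIV (blinfun_apply f) * norm x"
    proof (cases "x = 0")
      case False
      then have "\<bar>blinfun_apply f x\<bar> / norm x \<le> dual_norm_on UNIV (blinfun_apply f)"
        using upper[of "x /\<^sub>R norm x"] by (simp add: blinfun.scaleR_right abs_mult divide_simps)
      with False show ?thesis
        by (simp add: field_simps)
    qed simp
  qed
qed

lemma dual_dist_on_UNIV:
  "dual_dist_on UNIV (blinfun_apply f) (blinfun_apply g) = dist f g"
  unfolding dual_dist_on_def dist_norm dual_norm_on_UNIV[symmetric]
  by (simp add: blinfun.diff_left[abs_def])

lemma dual_diameter_on_UNIV:
  "dual_diameter_on UNIV (blinfun_apply ` S) = diameter S"
proof -
  have "(\<lambda>(f, g). dual_dist_on UNIV f g) ` (blinfun_apply ` S \<times> blinfun_apply ` S)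
      = (\<lambda>(f, g). dist f g) ` (S \<times> S)"
    by (force simp: dual_dist_on_UNIV image_iff)
  then show ?thesis
    by (simp add: dual_diameter_on_def diameter_def)
qed

lemma wstar_slice_on_UNIV:
  "wstar_slice_on (blinfun_apply ` C) x \<alpha> = blinfun_apply ` wstar_slice C x \<alpha>"
  by (auto simp: wstar_slice_on_def wstar_slice_def image_image)

lemma dual_ball_on_UNIV:
  "dual_ball_on (UNIV :: 'a::real_normed_vector set) = blinfun_apply ` cball 0 1"
  by (auto simp: dual_ball_on_def dual_on_UNIV dual_norm_on_UNIV)

lemma wstar_BDP_on_UNIV:
  "wstar_BDP_on (UNIV :: 'a::real_normed_vector set) \<longleftrightarrow> wstar_BDP TYPE('a)"
  by (simp add: wstar_BDP_on_def wstar_BDP_def dual_ball_on_UNIV wstar_slice_on_UNIV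
      dual_diameter_on_UNIV)

end

theory Submission
  imports Defs
begin

text \<open>By Hahn-Banach, the \<open>L\<close>-projection \<open>P\<close> satisfies \<open>\<parallel>P f\<parallel> \<le> \<parallel>f|M\<parallel>\<close>: a norm-preserving
  extension \<open>g\<close> of \<open>f|M\<close> has \<open>P g = P f\<close>. If \<open>x \<in> M\<close> is a unit vector, \<open>\<parallel>f\<parallel> \<le> 1\<close> and \<open>f x > 1 - \<beta>\<close>,
  then \<open>\<parallel>f - P f\<parallel> = \<parallel>f\<parallel> - \<parallel>P f\<parallel> < \<beta>\<close> because \<open>P f x = f x\<close>. So any two elements of a thin slice of
  the dual ball determined by \<open>x\<close> differ by at most \<open>2 * \<beta>\<close> more than their restrictions to \<open>M\<close>.\<close>

section \<open>Sublinear functionals and the Hahn-Banach theorem\<close>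

definition sublinear :: "('a::real_vector \<Rightarrow> real) \<Rightarrow> bool" where
  "sublinear q \<longleftrightarrow> (\<forall>x y. q (x + y) \<le> q x + q y) \<and> (\<forall>t\<ge>0. \<forall>x. q (t *\<^sub>R x) = t * q x)"

text \<open>The reverse inequality comes from \<open>le\<close> with factor \<open>1 / t\<close> at
  the point \<open>t *\<^sub>R x\<close>.\<close>

lemma sublinearI:
  assumes "\<And>x y. q (x + y) \<le> q x + q y" "q 0 = 0"
    and le: "\<And>t x. t > 0 \<Longrightarrow> q (t *\<^sub>R x) \<le> t * q x"
  shows "sublinear q"
proof -
  have "q (t *\<^sub>R x) = t * q x" if "t \<ge> 0" for t x
  proof (cases "t = 0")
    case False
    then have t: "t > 0" using that by simp
    have "q ((1 / t) *\<^sub>R (t *\<^sub>R x)) \<le> (1 / t) * q (t *\<^sub>R x)"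
      using t by (intro le) simp
    then have "t * q x \<le> q (t *\<^sub>R x)" using t by (simp add: field_simps)
    with le[OF t, of x] show ?thesis by simp
  qed (simp add: assms)
  with assms show ?thesis by (simp add: sublinear_def)
qed

lemma sublinear_add: "sublinear q \<Longrightarrow> q (x + y) \<le> q x + q y"
  by (simp add: sublinear_def)

lemma sublinear_scale: "sublinear q \<Longrightarrow> t \<ge> 0 \<Longrightarrow> q (t *\<^sub>R x) = t * q x"
  by (simp add: sublinear_def)

lemma sublinear_zero: "sublinear q \<Longrightarrow> q 0 = 0"
  using sublinear_scale[of q 0 0] by simp

lemma sublinear_ge_minus: "sublinear q \<Longrightarrow> - q (- x) \<le> q x"
  using sublinear_add[of q x "- x"] sublinear_zero[of q] by simp

lemma sublinear_norm: "K \<ge> 0 \<Longrightarrow> sublinear (\<lambda>x. K * norm x)"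
  by (simp add: sublinear_def ring_distribs(1)[symmetric] mult_left_mono norm_triangle_ineq)

text \<open>Any linear \<open>L\<close> below \<open>p\<close> satisfies
  \<open>L x \<le> q x\<close> (take \<open>d = 0\<close>) and \<open>g d \<le> L d\<close> on
  \<open>D\<close> (take \<open>x = - d\<close>). Dominating \<open>g\<close> on the cone thus
  reduces to finding a linear minorant of \<open>p\<close>.\<close>

lemma sublinear_infconv:
  fixes q g :: "'a::real_vector \<Rightarrow> real"
  assumes q: "sublinear q"
    and D: "0 \<in> D" "\<And>d e. d \<in> D \<Longrightarrow> e \<in> D \<Longrightarrow> d + e \<in> D"
      "\<And>t d. t \<ge> 0 \<Longrightarrow> d \<in> D \<Longrightarrow> t *\<^sub>R d \<in> D"
    and g: "\<And>d e. d \<in> D \<Longrightarrow> e \<in> D \<Longrightarrow> g (d + e) = g d + g e"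
      "\<And>t d. t \<ge> 0 \<Longrightarrow> d \<in> D \<Longrightarrow> g (t *\<^sub>R d) = t * g d"
    and le: "\<And>d. d \<in> D \<Longrightarrow> g d \<le> q d"
  defines "p \<equiv> \<lambda>x. INF d\<in>D. q (x + d) - g d"
  shows "sublinear p" and "\<And>x d. d \<in> D \<Longrightarrow> p x \<le> q (x + d) - g d"
proof -
  \<comment> \<open>From \<open>g d \<le> q d \<le> q (x + d) + q (- x)\<close>; a lower bound
    independent of \<open>d\<close> is what makes the infimum meaningful.\<close>
  have "- q (- x) \<le> q (x + d) - g d" if "d \<in> D" for x d
    using sublinear_add[OF q, of "x + d" "- x"] le[OF that] by simp
  then have "bdd_below ((\<lambda>d. q (x + d) - g d) ` D)" for x
    by (rule bdd_belowI2)
  then show lower: "p x \<le> q (x + d) - g d" if "d \<in> D" for x d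
    unfolding p_def by (rule cINF_lower[OF _ that])
  have greatest: "c \<le> p x" if "\<And>d. d \<in> D \<Longrightarrow> c \<le> q (x + d) - g d" for c x
    unfolding p_def using D(1) that by (intro cINF_greatest) auto
  show "sublinear p"
  proof (rule sublinearI)
    fix x y
    \<comment> \<open>The two infima are taken one after the other: first over \<open>d\<close> with
      \<open>e\<close> fixed, then over \<open>e\<close>.\<close>
    have "p (x + y) - (q (y + e) - g e) \<le> q (x + d) - g d" if "d \<in> D" "e \<in> D" for d e
      using lower[OF D(2)[OF that], of "x + y"] g(1)[OF that]
        sublinear_add[OF q, of "x + d" "y + e"] by (simp add: algebra_simps)
    then have "p (x + y) - p x \<le> q (y + e) - g e" if "e \<in> D" for e
      using greatest[of "p (x + y) - (q (y + e) - g e)" x] that by fastforce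
    then show "p (x + y) \<le> p x + p y"
      using greatest[of "p (x + y) - p x" y] by fastforce
  next
    have "g 0 = 0" using g(2)[of 0 0] D(1) by simp
    then have "p 0 \<le> 0" using lower[OF D(1), of 0] sublinear_zero[OF q] by simp
    moreover have "0 \<le> p 0" by (rule greatest) (simp add: le)
    ultimately show "p 0 = 0" by simp
  next
    fix t :: real and x
    assume t: "t > 0"
    \<comment> \<open>Testing the infimum at \<open>t *\<^sub>R d\<close> instead of
      \<open>d\<close> lets the factor \<open>t\<close> be pulled out.\<close>
    have "p (t *\<^sub>R x) / t \<le> q (x + d) - g d" if "d \<in> D" for d
    proof -
      have "p (t *\<^sub>R x) \<le> t * q (x + d) - t * g d"
        using lower[OF D(3)[OF _ that], of t "t *\<^sub>R x"] t g(2)[OF _ that, of t]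
          sublinear_scale[OF q, of t "x + d"] by (simp add: scaleR_add_right)
      then show ?thesis using t by (simp add: field_simps)
    qed
    then have "p (t *\<^sub>R x) / t \<le> p x" by (rule greatest)
    then show "p (t *\<^sub>R x) \<le> t * p x" using t by (simp add: field_simps)
  qed
qed

text \<open>Rays serve as cones because a positively homogeneous function, such as a sublinear
  functional or the norm, is additive along a ray and can therefore play the part of
  \<open>g\<close>.\<close>

lemma ray_closed:
  fixes y :: "'a::real_vector"
  defines "D \<equiv> {t *\<^sub>R y | t. t \<ge> 0}"
  shows "0 \<in> D" "y \<in> D" "\<And>d e. d \<in> D \<Longrightarrow> e \<in> D \<Longrightarrow> d + e \<in> D"
    "\<And>t d. t \<ge> 0 \<Longrightarrow> d \<in> D \<Longrightarrow> t *\<^sub>R d \<in> D"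
proof -
  have D: "t *\<^sub>R y \<in> D" if "t \<ge> 0" for t
    using that by (auto simp: D_def)
  show "0 \<in> D" "y \<in> D" using D[of 0] D[of 1] by simp_all
  show "d + e \<in> D" if "d \<in> D" "e \<in> D" for d e
    using that by (auto simp: D_def simp flip: scaleR_add_left intro: D[unfolded D_def, simplified])
  show "t *\<^sub>R d \<in> D" if "t \<ge> 0" "d \<in> D" for t d
    using that by (auto simp: D_def)
qed

text \<open>Lowering \<open>q\<close> to \<open>p x = (INF t\<in>{0..}. q (x + t *\<^sub>R y) - t * q y)\<close> cannot change a minimal \<open>q\<close>,
  and \<open>t = 1\<close> then gives superadditivity.\<close>

lemma minimal_sublinear_linear:
  fixes q :: "'a::real_vector \<Rightarrow> real"
  assumes q: "sublinear q" and min: "\<And>r. sublinear r \<Longrightarrow> r \<le> q \<Longrightarrow> r = q"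
  shows "linear q"
proof -
  have super: "q x + q y \<le> q (x + y)" for x y
  proof -
    define D where "D = {t *\<^sub>R y | t. t \<ge> 0}"
    define p where "p x = (INF d\<in>D. q (x + d) - q d)" for x
    note D = ray_closed[where y = y, folded D_def]
    have add: "q (d + e) = q d + q e" if "d \<in> D" "e \<in> D" for d e
      using that sublinear_scale[OF q] unfolding D_def
      by (auto simp: ring_distribs simp flip: scaleR_add_left)
    have p: "sublinear p" "\<And>x d. d \<in> D \<Longrightarrow> p x \<le> q (x + d) - q d"
      unfolding p_def
      by (rule sublinear_infconv[OF q]; use D add sublinear_scale[OF q] in simp)+
    have "p \<le> q"
      using p(2)[OF D(1)] sublinear_zero[OF q] by (simp add: le_fun_def)
    then have "p = q" using min p(1) by blast
    then show ?thesis using p(2)[OF D(2), of x] by simp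
  qed
  have add: "q (x + y) = q x + q y" for x y
    using super[of x y] sublinear_add[OF q, of x y] by simp
  \<comment> \<open>Oddness carries homogeneity from nonnegative to negative factors.\<close>
  have neg: "q (- x) = - q x" for x
    using add[of x "- x"] sublinear_zero[OF q] by simp
  have "q (t *\<^sub>R x) = t *\<^sub>R q x" for t x
  proof (cases "t \<ge> 0")
    case False
    then show ?thesis
      using neg[of "(- t) *\<^sub>R x"] sublinear_scale[OF q, of "- t" x] by simp
  qed (simp add: sublinear_scale[OF q])
  with add show ?thesis by (rule linearI)
qed

text \<open>Zorn's lemma yields a minimal sublinear functional below \<open>p\<close>, and
  minimality forces linearity.\<close>

lemma sublinear_linear_minorant:
  fixes p :: "'a::real_vector \<Rightarrow> real"
  assumes p: "sublinear p"
  obtains L where "linear L" "L \<le> p"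
proof -
  define A where "A = {q. sublinear q \<and> q \<le> p}"
  \<comment> \<open>The order is reversed, so the maximal element that Zorn's lemma provides is
    pointwise minimal.\<close>
  have "\<exists>m\<in>A. \<forall>a\<in>A. a \<le> m \<longrightarrow> a = m"
  proof (rule predicate_Zorn)
    show "partial_order_on A (relation_of (\<lambda>a b. b \<le> a) A)"
      by (rule partial_order_on_relation_ofI) auto
  next
    fix C assume "C \<in> Chains (relation_of (\<lambda>a b. b \<le> a) A)"
    then have CA: "C \<subseteq> A" and chain: "\<And>a b. a \<in> C \<Longrightarrow> b \<in> C \<Longrightarrow> a \<le> b \<or> b \<le> a"
      by (auto simp: Chains_def relation_of_def)
    show "\<exists>u\<in>A. \<forall>a\<in>C. u \<le> a"
    \<comment> \<open>The empty chain is bounded by \<open>p\<close> itself; the pointwise infimum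
      below needs a nonempty chain.\<close>
    proof (cases "C = {}")
      case True
      then show ?thesis using p by (auto simp: A_def)
    next
      case False
      define u where "u x = (INF a\<in>C. a x)" for x
      have C: "sublinear a" "a \<le> p" if "a \<in> C" for a
        using CA that by (auto simp: A_def)
      \<comment> \<open>From \<open>- p (- x) \<le> - a (- x) \<le> a x\<close>, a bound uniform
        over the chain.\<close>
      have "- p (- x) \<le> a x" if "a \<in> C" for a x
        using sublinear_ge_minus[OF C(1)[OF that], of x] le_funD[OF C(2)[OF that], of "- x"] by simp
      then have "bdd_below ((\<lambda>a. a x) ` C)" for x
        by (rule bdd_belowI2)
      then have lower: "u x \<le> a x" if "a \<in> C" for a x
        unfolding u_def by (rule cINF_lower[OF _ that])
      have greatest: "c \<le> u x" if "\<And>a. a \<in> C \<Longrightarrow> c \<le> a x" for c x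
        unfolding u_def using False that by (intro cINF_greatest) auto
      have "sublinear u"
      proof (rule sublinearI)
        fix x y
        \<comment> \<open>An infimum of sublinear functionals need not be subadditive. In a chain,
          the smaller of \<open>a\<close> and \<open>b\<close> can be used at both \<open>x\<close>
          and \<open>y\<close>.\<close>
        have "u (x + y) - b y \<le> a x" if "a \<in> C" "b \<in> C" for a b
          using chain[OF that]
        proof
          assume "a \<le> b"
          then show ?thesis
            using lower[OF that(1), of "x + y"] sublinear_add[OF C(1)[OF that(1)], of x y]
              le_funD[of a b y] by simp
        next
          assume "b \<le> a"
          then show ?thesis
            using lower[OF that(2), of "x + y"] sublinear_add[OF C(1)[OF that(2)], of x y]
              le_funD[of b a x] by simp
        qed
        then have "u (x + y) - u x \<le> b y" if "b \<in> C" for b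
          using greatest[of "u (x + y) - b y" x] that by fastforce
        then show "u (x + y) \<le> u x + u y"
          using greatest[of "u (x + y) - u x" y] by fastforce
      next
        show "u 0 = 0"
          using False by (simp add: u_def sublinear_zero[OF C(1)])
      next
        fix t :: real and x
        assume t: "t > 0"
        have "u (t *\<^sub>R x) / t \<le> a x" if "a \<in> C" for a
          using lower[OF that, of "t *\<^sub>R x"] sublinear_scale[OF C(1)[OF that], of t x] t
          by (simp add: field_simps)
        then have "u (t *\<^sub>R x) / t \<le> u x" by (rule greatest)
        then show "u (t *\<^sub>R x) \<le> t * u x" using t by (simp add: field_simps)
      qed
      moreover have "u \<le> a" if "a \<in> C" for a
        using lower[OF that] by (simp add: le_fun_def)
      ultimately show ?thesis
        using False C(2) unfolding A_def by (blast intro: order_trans)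
    qed
  qed
  then obtain m where "m \<in> A" "\<And>a. a \<in> A \<Longrightarrow> a \<le> m \<Longrightarrow> a = m"
    by blast
  \<comment> \<open>Minimality in \<open>A\<close> is minimality among all sublinear functionals,
    since anything below \<open>m\<close> is below \<open>p\<close>.\<close>
  then have "sublinear m" "m \<le> p" "\<And>r. sublinear r \<Longrightarrow> r \<le> m \<Longrightarrow> r = m"
    by (auto simp: A_def intro: order_trans)
  then show ?thesis using that minimal_sublinear_linear by blast
qed

section \<open>Hahn-Banach on cones, norming functionals and norm-preserving extensions\<close>

text \<open>A cone that need not be symmetric covers two uses: on a ray the one-sided estimate gives
  a norming functional, on a subspace it becomes equality by passing to \<open>- d\<close>.\<close>

lemma Hahn_Banach_cone:
  fixes q g :: "'a::real_vector \<Rightarrow> real"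
  assumes q: "sublinear q"
    and D: "0 \<in> D" "\<And>d e. d \<in> D \<Longrightarrow> e \<in> D \<Longrightarrow> d + e \<in> D"
      "\<And>t d. t \<ge> 0 \<Longrightarrow> d \<in> D \<Longrightarrow> t *\<^sub>R d \<in> D"
    and g: "\<And>d e. d \<in> D \<Longrightarrow> e \<in> D \<Longrightarrow> g (d + e) = g d + g e"
      "\<And>t d. t \<ge> 0 \<Longrightarrow> d \<in> D \<Longrightarrow> g (t *\<^sub>R d) = t * g d"
    and le: "\<And>d. d \<in> D \<Longrightarrow> g d \<le> q d"
  obtains L where "linear L" "\<And>x. L x \<le> q x" "\<And>d. d \<in> D \<Longrightarrow> g d \<le> L d"
proof -
  define p where "p x = (INF d\<in>D. q (x + d) - g d)" for x
  have p: "sublinear p" "\<And>x d. d \<in> D \<Longrightarrow> p x \<le> q (x + d) - g d"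
    unfolding p_def by (rule sublinear_infconv[OF q]; use D g le in simp)+
  obtain L where L: "linear L" "L \<le> p"
    using sublinear_linear_minorant[OF p(1)] .
  have *: "L x \<le> q (x + d) - g d" if "d \<in> D" for x d
    using le_funD[OF L(2), of x] p(2)[OF that, of x] by linarith
  have "g 0 = 0" using g(2)[of 0 0] D(1) by simp
  with L(1) *[OF D(1)] *[of d "- d" for d] show ?thesis
    by (intro that[of L]) (simp_all add: sublinear_zero[OF q] linear_neg)
qed

text \<open>The one-sided bound at \<open>x\<close> and at \<open>- x\<close> bounds the absolute
  value.\<close>

lemma linear_le_norm_Blinfun:
  fixes L :: "'a::real_normed_vector \<Rightarrow> real"
  assumes L: "linear L" and le: "\<And>x. L x \<le> K * norm x" and K: "K \<ge> 0"
  obtains h :: "'a \<Rightarrow>\<^sub>L real" where "blinfun_apply h = L" "norm h \<le> K"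
proof -
  have abs: "norm (L x) \<le> K * norm x" for x
    using le[of x] le[of "- x"] by (simp add: linear_neg[OF L] abs_le_iff)
  then have "bounded_linear L"
    using L by (intro bounded_linear_intro[of L K]) (simp_all add: linear_add linear_scale mult.commute)
  then have "blinfun_apply (Blinfun L) = L" by (rule bounded_linear_Blinfun_apply)
  with abs K show ?thesis
    by (intro that[of "Blinfun L"] norm_blinfun_bound) simp_all
qed

lemma norming_functional:
  fixes x :: "'a::real_normed_vector"
  obtains h :: "'a \<Rightarrow>\<^sub>L real" where "norm h \<le> 1" "blinfun_apply h x = norm x"
proof -
  define D where "D = {t *\<^sub>R x | t. t \<ge> 0}"
  note D = ray_closed[where y = x, folded D_def]
  obtain L where L: "linear L" "\<And>y. L y \<le> 1 * norm y" "\<And>d. d \<in> D \<Longrightarrow> norm d \<le> L d"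
  \<comment> \<open>The factor \<open>1\<close> gives the majorant the form
    \<open>K * norm y\<close> of \<open>sublinear_norm\<close> and
    \<open>linear_le_norm_Blinfun\<close>.\<close>
  proof (rule Hahn_Banach_cone[of "\<lambda>y. 1 * norm y" D norm])
    show "sublinear (\<lambda>y::'a. 1 * norm y)" by (rule sublinear_norm) simp
    show "norm (d + e) = norm d + norm e" if "d \<in> D" "e \<in> D" for d e
      using that unfolding D_def by (auto simp: ring_distribs simp flip: scaleR_add_left)
  qed (use D in auto)
  obtain h where h: "blinfun_apply h = L" "norm h \<le> 1"
    using linear_le_norm_Blinfun[OF L(1,2)] by auto
  have "L x = norm x" using L(2)[of x] L(3)[OF D(2)] by simp
  with h show ?thesis by (intro that[of h]) simp_all
qed

lemma norm_preserving_extension: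
  fixes f :: "'a::real_normed_vector \<Rightarrow>\<^sub>L real"
  assumes M: "subspace M" and le: "\<And>x. x \<in> M \<Longrightarrow> \<bar>blinfun_apply f x\<bar> \<le> K * norm x" and K: "K \<ge> 0"
  obtains h :: "'a \<Rightarrow>\<^sub>L real"
    where "norm h \<le> K" "\<And>x. x \<in> M \<Longrightarrow> blinfun_apply h x = blinfun_apply f x"
proof -
  obtain L where L: "linear L" "\<And>y. L y \<le> K * norm y" "\<And>d. d \<in> M \<Longrightarrow> blinfun_apply f d \<le> L d"
  proof (rule Hahn_Banach_cone[of "\<lambda>y. K * norm y" M "blinfun_apply f"])
    show "sublinear (\<lambda>y::'a. K * norm y)" using K by (rule sublinear_norm)
    show "blinfun_apply f d \<le> K * norm d" if "d \<in> M" for d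
      using le[OF that] by simp
  qed (use M in \<open>auto simp: subspace_def blinfun.add_right blinfun.scaleR_right\<close>)
  obtain h where h: "blinfun_apply h = L" "norm h \<le> K"
    using linear_le_norm_Blinfun[OF L(1,2) K] .
  have "L x = blinfun_apply f x" if "x \<in> M" for x
    using L(3)[OF that] L(3)[OF subspace_neg[OF M that]]
    by (simp add: linear_neg[OF L(1)] blinfun.minus_right)
  with h show ?thesis by (intro that[of h]) simp_all
qed

section \<open>Functionals on a subspace\<close>

text \<open>Normalising \<open>x\<close> moves it into the unit ball of \<open>M\<close>;
  \<open>K\<close> ensures that the supremum over that ball is finite.\<close>

lemma abs_le_dual_norm_on:
  assumes M: "subspace M" and f: "\<And>c x. x \<in> M \<Longrightarrow> f (c *\<^sub>R x) = c * f x"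
    and bound: "\<And>x. x \<in> M \<Longrightarrow> \<bar>f x\<bar> \<le> K * norm x" and x: "x \<in> M"
  shows "\<bar>f x\<bar> \<le> dual_norm_on M f * norm x"
proof (cases "x = 0")
  case True
  then show ?thesis using f[OF x, of 0] by simp
next
  case False
  \<comment> \<open>The sign of \<open>K\<close> is not known, hence the absolute value.\<close>
  have "\<bar>f y\<bar> \<le> \<bar>K\<bar>" if "y \<in> M" "norm y \<le> 1" for y
  proof -
    have "K * norm y \<le> \<bar>K\<bar> * 1" using that(2) by (intro mult_mono) auto
    with bound[OF that(1)] show ?thesis by simp
  qed
  then have "bdd_above ((\<lambda>y. \<bar>f y\<bar>) ` {y\<in>M. norm y \<le> 1})"
    by (intro bdd_aboveI2) auto
  moreover have "(1 / norm x) *\<^sub>R x \<in> {y\<in>M. norm y \<le> 1}"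
    using M x False by (simp add: subspace_scale)
  ultimately have "\<bar>f ((1 / norm x) *\<^sub>R x)\<bar> \<le> dual_norm_on M f"
    unfolding dual_norm_on_def by (intro cSUP_upper)
  then show ?thesis using False by (simp add: f[OF x] abs_mult field_simps)
qed

lemma dual_norm_on_le:
  assumes "subspace M" "\<And>x. x \<in> M \<Longrightarrow> norm x \<le> 1 \<Longrightarrow> \<bar>f x\<bar> \<le> K"
  shows "dual_norm_on M f \<le> K"
  unfolding dual_norm_on_def using assms subspace_0[of M] by (intro cSUP_least) (auto intro: exI[of _ 0])

lemma dual_ball_on_abs_le:
  assumes "subspace M" "f \<in> dual_ball_on M" "x \<in> M"
  shows "\<bar>f x\<bar> \<le> norm x"
proof -
  obtain K where "\<forall>x\<in>M. \<bar>f x\<bar> \<le> K * norm x"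
    using assms(2) by (auto simp: dual_ball_on_def dual_on_def)
  then have "\<bar>f x\<bar> \<le> dual_norm_on M f * norm x"
    using assms by (intro abs_le_dual_norm_on[of M f K]) (auto simp: dual_ball_on_def dual_on_def)
  also have "\<dots> \<le> 1 * norm x"
    using assms(2) by (intro mult_right_mono) (auto simp: dual_ball_on_def)
  finally show ?thesis by simp
qed

lemma blinfun_abs_le:
  fixes f :: "'a::real_normed_vector \<Rightarrow>\<^sub>L real"
  assumes "norm f \<le> K"
  shows "\<bar>blinfun_apply f x\<bar> \<le> K * norm x"
  using norm_blinfun[of f x] mult_right_mono[OF assms norm_ge_zero[of x]] by simp

lemma restrict_in_dual_ball_on:
  fixes f :: "'a::real_normed_vector \<Rightarrow>\<^sub>L real"
  assumes M: "subspace M" and f: "norm f \<le> 1"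
  shows "restrict (blinfun_apply f) M \<in> dual_ball_on M"
proof -
  have "dual_norm_on M (restrict (blinfun_apply f) M) \<le> 1"
    using blinfun_abs_le[OF f] by (intro dual_norm_on_le[OF M]) (auto intro: order_trans)
  moreover have "restrict (blinfun_apply f) M \<in> dual_on M"
    using M blinfun_abs_le[OF f]
    by (auto simp: dual_on_def blinfun.add_right blinfun.scaleR_right subspace_add subspace_scale
        intro!: exI[of _ 1])
  ultimately show ?thesis by (simp add: dual_ball_on_def)
qed

lemma dual_dist_on_le_diameter:
  assumes M: "subspace M" and S: "S \<subseteq> dual_ball_on M" and fg: "f \<in> S" "g \<in> S"
  shows "dual_dist_on M f g \<le> dual_diameter_on M S"
proof -
  \<comment> \<open>Two elements of the dual ball are at distance at most 2, so the supremum in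
    \<open>dual_diameter_on\<close> is bounded.\<close>
  have "dual_dist_on M a b \<le> 2" if "a \<in> S" "b \<in> S" for a b
    unfolding dual_dist_on_def
  proof (rule dual_norm_on_le[OF M])
    fix x assume x: "x \<in> M" "norm x \<le> 1"
    then have "\<bar>a x\<bar> \<le> norm x" "\<bar>b x\<bar> \<le> norm x"
      using dual_ball_on_abs_le[OF M] S that by auto
    with x show "\<bar>a x - b x\<bar> \<le> 2" by linarith
  qed
  then have "bdd_above ((\<lambda>(a, b). dual_dist_on M a b) ` (S \<times> S))"
    by (intro bdd_aboveI2[of _ _ 2]) auto
  then have "(\<lambda>(a, b). dual_dist_on M a b) (f, g) \<le> (SUP (a, b)\<in>S \<times> S. dual_dist_on M a b)"
    using fg by (intro cSUP_upper) auto
  with fg show ?thesis by (auto simp: dual_diameter_on_def)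
qed

lemma restrict_in_wstar_slice_on:
  fixes f :: "'a::real_normed_vector \<Rightarrow>\<^sub>L real"
  assumes M: "subspace M" and x: "x \<in> M" and f: "norm f \<le> 1"
    and gt: "blinfun_apply f x > norm x - \<alpha>"
  shows "restrict (blinfun_apply f) M \<in> wstar_slice_on (dual_ball_on M) x \<alpha>"
proof -
  \<comment> \<open>The restriction of \<open>f\<close> also witnesses that the dual ball is
    nonempty, as \<open>cSUP_least\<close> requires.\<close>
  have "(SUP g\<in>dual_ball_on M. g x) \<le> norm x"
    using dual_ball_on_abs_le[OF M _ x] restrict_in_dual_ball_on[OF M f]
    by (intro cSUP_least) (auto simp: abs_le_iff)
  with gt x restrict_in_dual_ball_on[OF M f] show ?thesis
    by (simp add: wstar_slice_on_def)
qed

text \<open>A norming functional attains the supremum. For a unit vector \<open>x\<close>, the slice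
  condition thus becomes \<open>f x > 1 - \<alpha>\<close>.\<close>

lemma SUP_dual_ball_eq_norm:
  fixes x :: "'a::real_normed_vector"
  shows "(SUP g\<in>cball (0 :: 'a \<Rightarrow>\<^sub>L real) 1. blinfun_apply g x) = norm x"
proof (rule antisym)
  have le: "blinfun_apply g x \<le> norm x" if "g \<in> cball 0 1" for g :: "'a \<Rightarrow>\<^sub>L real"
    using blinfun_abs_le[of g 1 x] that by simp
  then show "(SUP g\<in>cball (0 :: 'a \<Rightarrow>\<^sub>L real) 1. blinfun_apply g x) \<le> norm x"
    by (intro cSUP_least) auto
  obtain h :: "'a \<Rightarrow>\<^sub>L real" where h: "norm h \<le> 1" "blinfun_apply h x = norm x"
    by (rule norming_functional)
  have "bdd_above ((\<lambda>g. blinfun_apply g x) ` cball (0 :: 'a \<Rightarrow>\<^sub>L real) 1)"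
    using le by (rule bdd_aboveI2)
  with h show "norm x \<le> (SUP g\<in>cball (0 :: 'a \<Rightarrow>\<^sub>L real) 1. blinfun_apply g x)"
    by (metis cSUP_upper mem_cball_0)
qed

section \<open>L-projections with kernel \<open>annihilator M\<close>, and the passage from slices
  over \<open>M\<close> to slices over the whole space\<close>

lemma L_projection_norm_le_dual_norm_on:
  fixes P :: "('a::real_normed_vector \<Rightarrow>\<^sub>L real) \<Rightarrow> ('a \<Rightarrow>\<^sub>L real)"
  assumes M: "subspace M" and P: "L_projection P" and ker: "{f. P f = 0} = annihilator M"
  shows "norm (P f) \<le> dual_norm_on M (blinfun_apply f)"
proof -
  let ?K = "dual_norm_on M (blinfun_apply f)"
  have le: "\<bar>blinfun_apply f x\<bar> \<le> ?K * norm x" if "x \<in> M" for x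
    using M blinfun_abs_le[OF order_refl, of f] that
    by (intro abs_le_dual_norm_on) (auto simp: blinfun.scaleR_right)
  \<comment> \<open>Boundedness lets the supremum be compared with its value at 0, giving the
    \<open>?K \<ge> 0\<close> required for the extension.\<close>
  have "bdd_above ((\<lambda>y. \<bar>blinfun_apply f y\<bar>) ` {y\<in>M. norm y \<le> 1})"
  proof (rule bdd_aboveI2)
    fix y assume "y \<in> {y\<in>M. norm y \<le> 1}"
    then show "\<bar>blinfun_apply f y\<bar> \<le> norm f"
      using blinfun_abs_le[OF order_refl, of f y] mult_left_le[of "norm y" "norm f"] by simp
  qed
  then have "\<bar>blinfun_apply f 0\<bar> \<le> ?K"
    unfolding dual_norm_on_def using subspace_0[OF M] by (intro cSUP_upper) auto
  then have "?K \<ge> 0" by simp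
  then obtain h where h: "norm h \<le> ?K" "\<And>x. x \<in> M \<Longrightarrow> blinfun_apply h x = blinfun_apply f x"
    using norm_preserving_extension[OF M le] by blast
  have "f - h \<in> annihilator M" using h(2) by (simp add: annihilator_def blinfun.diff_left)
  then have "P (f - h) = 0" using ker by blast
  then have "P f = P h" using P by (simp add: L_projection_def linear_diff)
  moreover have "norm (P h) \<le> norm h"
    using P norm_ge_zero[of "h - P h"] unfolding L_projection_def by (metis le_add_same_cancel1)
  ultimately show ?thesis using h(1) by simp
qed

text \<open>By idempotence \<open>f - P f\<close> lies in the kernel of \<open>P\<close>, hence
  vanishes on \<open>M\<close>.\<close>

lemma L_projection_apply:
  fixes P :: "('a::real_normed_vector \<Rightarrow>\<^sub>L real) \<Rightarrow> ('a \<Rightarrow>\<^sub>L real)"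
  assumes P: "L_projection P" and ker: "{f. P f = 0} = annihilator M" and x: "x \<in> M"
  shows "blinfun_apply (P f) x = blinfun_apply f x"
proof -
  have "P (f - P f) = 0"
    using P by (simp add: L_projection_def linear_diff) (metis comp_apply)
  then have "f - P f \<in> annihilator M" using ker by blast
  then show ?thesis using x by (simp add: annihilator_def blinfun.diff_left)
qed

theorem proposition6:
  fixes M :: "'a::banach set"
  assumes "M_ideal M"
    and "wstar_BDP_on M"
  shows "wstar_BDP TYPE('a)"
proof -
  obtain P :: "('a \<Rightarrow>\<^sub>L real) \<Rightarrow> ('a \<Rightarrow>\<^sub>L real)"
    where M: "subspace M" and P: "L_projection P" and ker: "{f. P f = 0} = annihilator M"
    using assms(1) by (auto simp: M_ideal_def)
  show ?thesis
    unfolding wstar_BDP_def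
  proof (intro allI impI)
    fix \<epsilon> :: real
    assume \<epsilon>: "\<epsilon> > 0"
    then obtain x \<alpha> where x: "x \<in> M" "norm x = 1" and \<alpha>: "\<alpha> > 0"
      and diam: "dual_diameter_on M (wstar_slice_on (dual_ball_on M) x \<alpha>) < \<epsilon> / 2"
      using assms(2) unfolding wstar_BDP_on_def by (meson half_gt_zero)
    \<comment> \<open>The bound by \<open>\<alpha>\<close> sends restrictions into the given slice
      over \<open>M\<close>. The bound by \<open>\<epsilon> / 8\<close> limits the two errors
      \<open>f - P f\<close> and \<open>g - P g\<close> to \<open>\<epsilon> / 4\<close> together;
      with \<open>\<epsilon> / 2\<close> from \<open>diam\<close> this totals
      \<open>3 / 4 * \<epsilon>\<close>.\<close>
    define \<beta> where "\<beta> = min \<alpha> (\<epsilon> / 8)"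
    have \<beta>: "\<beta> > 0" "\<beta> \<le> \<alpha>" "\<beta> \<le> \<epsilon> / 8" using \<alpha> \<epsilon> by (auto simp: \<beta>_def)
    let ?S = "wstar_slice (cball (0 :: 'a \<Rightarrow>\<^sub>L real) 1) x \<beta>"
    have S: "norm f \<le> 1" "blinfun_apply f x > 1 - \<beta>" if "f \<in> ?S" for f
      using that x(2) by (auto simp: wstar_slice_def SUP_dual_ball_eq_norm)
    have near: "norm (f - P f) \<le> \<beta>" if "f \<in> ?S" for f
    proof -
      have "norm f = norm (P f) + norm (f - P f)" using P unfolding L_projection_def by blast
      moreover have "blinfun_apply f x \<le> norm (P f)"
        using blinfun_abs_le[OF order_refl, of "P f" x] L_projection_apply[OF P ker x(1), of f] x(2)
        by simp
      ultimately show ?thesis using S[OF that] by linarith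
    qed
    have "dist f g \<le> 3 / 4 * \<epsilon>" if "f \<in> ?S" "g \<in> ?S" for f g
    proof -
      let ?r = "\<lambda>f. restrict (blinfun_apply f) M"
      have r: "?r f \<in> wstar_slice_on (dual_ball_on M) x \<alpha>" if "f \<in> ?S" for f
        using S[OF that] x \<beta>(2) by (intro restrict_in_wstar_slice_on[OF M]) auto
      have "norm (P f - P g) = norm (P (f - g))"
        using linear_diff[of P f g] P unfolding L_projection_def by metis
      also have "\<dots> \<le> dual_norm_on M (blinfun_apply (f - g))"
        by (rule L_projection_norm_le_dual_norm_on[OF M P ker])
      also have "\<dots> = dual_dist_on M (?r f) (?r g)"
        unfolding dual_dist_on_def dual_norm_on_def
        by (intro arg_cong[where f = Sup] image_cong) (auto simp: blinfun.diff_left)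
      also have "\<dots> \<le> dual_diameter_on M (wstar_slice_on (dual_ball_on M) x \<alpha>)"
        using r[OF that(1)] r[OF that(2)]
        by (intro dual_dist_on_le_diameter[OF M]) (auto simp: wstar_slice_on_def)
      finally have "norm (P f - P g) \<le> \<epsilon> / 2" using diam by simp
      moreover have "norm (f - g) \<le> norm (f - P f) + norm (P f - P g) + norm (g - P g)"
        using norm_triangle_ineq4[of "(f - P f) + (P f - P g)" "g - P g"]
          norm_triangle_ineq[of "f - P f" "P f - P g"] by simp
      ultimately show ?thesis
        using near[OF that(1)] near[OF that(2)] \<beta>(3) by (simp add: dist_norm)
    qed
    \<comment> \<open>A diameter inherits only the non-strict bound; the slack below
      \<open>\<epsilon>\<close> makes the final inequality strict.\<close>
    then have "diameter ?S \<le> 3 / 4 * \<epsilon>"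
      using \<epsilon> by (intro diameter_le) (auto simp: dist_norm)
    with \<epsilon> x(2) \<beta>(1) show "\<exists>(x::'a) \<alpha>. norm x = 1 \<and> \<alpha> > 0 \<and> diameter (wstar_slice (cball 0 1) x \<alpha>) < \<epsilon>"
      by (intro exI[of _ x] exI[of _ \<beta>]) auto
  qed
qed

end
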